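(* Let $P\subset\mathbb{R}^3$ be a lattice polytope and let $Q_1+\cdots+Q_N\subseteq P$ be a maximal decomposition in $P$. For each $i$ let $I(Q_i)$ denote the number of lattice points in the interior of $Q_i$ with respect to the topology of $\mathbb{R}^3$. Then $$I=\sum_{i=1}^{N} I(Q_i)\le 4.$$ Furthermore, if $I(Q_i)>0$ for more than one index $i$, then $I\le 2$.
   Context: A lattice polytope in $\mathbb{R}^n$ is the convex hull of a finite non-empty set of points of $\mathbb{Z}^n$; it is non-trivial if it is not a single point. A lattice segment is primitive if its only lattice points are its two endpoints. The Minkowski sum of $P,Q\subset\mathbb{R}^n$ is $P+Q=\{p+q : p\in P, q\in Q\}$. The Minkowski length $L(P)$ of a lattice polytope $P\subset\mathbb{R}^n$ is the largest number $L$ of primitive lattice segments $E_1,\dots,E_L$ in $\mathbb{R}^n$ (not necessarily distinct) such that $E_1+\cdots+E_L\subseteq P$; equivalently, it is the largest number of non-trivial lattice polytopes whose Minkowski sum is contained in $P$. A maximal decomposition in $P$ is a collection of exactly $N=L(P)$ non-trivial lattice polytopes $Q_1,\dots,Q_N$ with $Q_1+\cdots+Q_N\subseteq P$. The $Q_i$ may have dimension less than 3, in which case $I(Q_i)=0$. *)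

theory Defs
  imports "HOL-Analysis.Analysis" "HOL-Library.Set_Algebras"
begin

definition integer_points :: "(real ^ 'n) set"
  where "integer_points = {x. \<forall>i. x $ i \<in> \<int>}"

definition lattice_polytope :: "(real ^ 'n) set \<Rightarrow> bool"
  where "lattice_polytope P \<longleftrightarrow>
    (\<exists>S. finite S \<and> S \<noteq> {} \<and> S \<subseteq> integer_points \<and> P = convex hull S)"

definition nontrivial_lattice_polytope :: "(real ^ 'n) set \<Rightarrow> bool"
  where "nontrivial_lattice_polytope P \<longleftrightarrow> lattice_polytope P \<and> (\<nexists>x. P = {x})"

definition primitive_segment :: "(real ^ 'n) set \<Rightarrow> bool"
  where "primitive_segment E \<longleftrightarrow>
    (\<exists>a b. a \<in> integer_points \<and> b \<in> integer_points \<and> a \<noteq> b \<and>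
           E = closed_segment a b \<and> E \<inter> integer_points = {a, b})"

text \<open>
  Addition of sets is the elementwise addition of \<^theory>\<open>HOL-Library.Set_Algebras\<close>,
  so the sum below is the Minkowski sum. The empty sum is the set \<open>{0}\<close>, which need not lie
  in \<open>P\<close>; the empty family is accepted nevertheless, so that a one-point polytope has
  Minkowski length 0 wherever it lies, as translation invariance demands.
\<close>

definition minkowski_sum_in :: "nat \<Rightarrow> (nat \<Rightarrow> (real ^ 'n) set) \<Rightarrow> (real ^ 'n) set \<Rightarrow> bool"
  where "minkowski_sum_in N Q P \<longleftrightarrow> N = 0 \<or> (\<Sum>i = 1..N. Q i) \<subseteq> P"

text \<open>
  The set of admissible \<open>L\<close> contains 0, and it is finite when \<open>P\<close> is a lattice polytope
  (or just bounded), so its \<open>Max\<close> is a genuine maximum.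
\<close>

definition minkowski_length :: "(real ^ 'n) set \<Rightarrow> nat"
  where "minkowski_length P =
    Max {L. \<exists>E. (\<forall>i\<in>{1..L}. primitive_segment (E i)) \<and> minkowski_sum_in L E P}"

definition maximal_decomposition ::
    "(real ^ 'n) set \<Rightarrow> nat \<Rightarrow> (nat \<Rightarrow> (real ^ 'n) set) \<Rightarrow> bool"
  where "maximal_decomposition P N Q \<longleftrightarrow>
    N = minkowski_length P \<and>
    (\<forall>i\<in>{1..N}. nontrivial_lattice_polytope (Q i)) \<and>
    minkowski_sum_in N Q P"

definition interior_lattice_points :: "(real ^ 'n) set \<Rightarrow> nat"
  where "interior_lattice_points Q = card (interior Q \<inter> integer_points)"

end

theory Submission
  imports Defs
begin

text \<open>
  Maximality means that a sum of \<open>k\<close> of the summands contains no lattice zonotope with \<open>k + 1\<close>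
  generators. For \<open>k = 1\<close> the lattice points of a summand are distinct mod 2, so there are at most
  8 of them, and at least 4 are vertices.

  For \<open>k = 2\<close> let \<open>A\<close> and \<open>B\<close> be the lattice points of two summands with interior lattice points, so
  that both have at least 5 elements. Points of \<open>A + B\<close> congruent mod 3 are equal, so a difference of
  two points of \<open>A\<close> congruent mod 3 to a difference of two points of \<open>B\<close> is equal to it; \<open>A\<close> and \<open>B\<close> are
  Sidon sets; and if \<open>a - a' = b - b' \<noteq> 0\<close>, then the offset \<open>a - b\<close> does not depend on the common
  difference. Four points of \<open>A\<close> in an affine plane mod 3 would take up all directions of that plane, at
  least one of them twice, and this contradicts the pigeonhole principle for \<open>B\<close> modulo the plane.
  So the differences of \<open>A\<close> are distinct mod 3, as are those of \<open>B\<close>. There are only 26 nonzero classes,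
  whence \<open>A\<close> and \<open>B\<close> have exactly 5 elements and at least 14 common differences; as these all come with
  the same offset, \<open>B\<close> is a translate of \<open>A\<close>. In particular each of the two summands has a single
  interior lattice point.

  For \<open>k = 3\<close> the three summands would contain translates of one tetrahedron with interior lattice
  point \<open>z0\<close>, and the four segments from \<open>z0\<close> to its vertices sum to a subset of three copies of it.
\<close>

section \<open>Lattice segments and the Minkowski length\<close>

text \<open>Lattice points are handled in the separate type \<open>int ^ 'n\<close>, where
  congruences and divisibility of coordinates make sense; this map embeds them into the real space
  that carries convexity.\<close>

definition of_int_vec :: "int ^ 'n \<Rightarrow> real ^ 'n"
  where "of_int_vec z = (\<chi> i. of_int (z $ i))"

lemma of_int_vec_nth [simp]: "of_int_vec z $ i = of_int (z $ i)"
  by (simp add: of_int_vec_def)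

lemma of_int_vec_add [simp]: "of_int_vec (x + y) = of_int_vec x + of_int_vec y"
  by (simp add: vec_eq_iff)

lemma of_int_vec_diff [simp]: "of_int_vec (x - y) = of_int_vec x - of_int_vec y"
  by (simp add: vec_eq_iff)

lemma of_int_vec_eq_iff [simp]: "of_int_vec x = of_int_vec y \<longleftrightarrow> x = y"
  by (simp add: vec_eq_iff)

lemma of_int_vec_eq_0_iff [simp]: "of_int_vec x = 0 \<longleftrightarrow> x = 0"
  by (simp add: vec_eq_iff)

lemma integer_points_eq_range: "integer_points = range of_int_vec"
proof (intro equalityI subsetI)
  fix x :: "real ^ 'n" assume "x \<in> integer_points"
  then have "x = of_int_vec (\<chi> i. \<lfloor>x $ i\<rfloor>)"
    by (auto simp: vec_eq_iff integer_points_def floor_of_int elim!: Ints_cases)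
  then show "x \<in> range of_int_vec" by blast
qed (auto simp: integer_points_def)

lemma of_int_vec_in_integer_points [simp]: "of_int_vec z \<in> integer_points"
  by (simp add: integer_points_eq_range)

lemma finite_bounded_of_int_vec:
  fixes S :: "(real ^ 'n) set"
  assumes "bounded S"
  shows "finite {z. of_int_vec z \<in> S}"
proof -
  obtain c where c: "\<And>x. x \<in> S \<Longrightarrow> norm x \<le> c"
    using assms by (auto simp: bounded_iff)
  have "\<bar>z $ i\<bar> \<le> \<lceil>c\<rceil>" if "of_int_vec z \<in> S" for z :: "int ^ 'n" and i
  proof -
    have "\<bar>real_of_int (z $ i)\<bar> \<le> c"
      using component_le_norm_cart[of "of_int_vec z" i] c[OF that] by simp
    then show ?thesis by linarith
  qed
  then have "($) ` {z. of_int_vec z \<in> S} \<subseteq> PiE UNIV (\<lambda>_. {- \<lceil>c\<rceil>..\<lceil>c\<rceil>})"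
    by (auto simp: abs_le_iff minus_le_iff)
  then have "finite (($) ` {z. of_int_vec z \<in> S})"
    by (rule finite_subset) (auto intro: finite_PiE)
  then show ?thesis
    by (rule finite_imageD) (simp add: inj_on_def vec_nth_inject)
qed

lemma finite_integer_points_bounded:
  assumes "bounded S"
  shows "finite (S \<inter> integer_points)"
proof -
  have "S \<inter> integer_points = of_int_vec ` {z. of_int_vec z \<in> S}"
    by (auto simp: integer_points_eq_range)
  then show ?thesis using finite_bounded_of_int_vec[OF assms] by simp
qed

text \<open>Among the finitely many lattice points of the segment other than \<open>x\<close>, let
  \<open>y'\<close> be one nearest to \<open>x\<close>. A lattice point strictly between
  \<open>x\<close> and \<open>y'\<close> would be nearer still.\<close>

lemma primitive_segment_in_segment:
  assumes "x \<in> integer_points" "y \<in> integer_points" "x \<noteq> y"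
  obtains E where "primitive_segment E" "E \<subseteq> closed_segment x y"
proof -
  define T where "T = closed_segment x y \<inter> integer_points - {x}"
  have "finite T" "y \<in> T"
    using assms finite_integer_points_bounded[OF bounded_closed_segment] by (auto simp: T_def)
  then obtain y' where y': "y' \<in> T" "\<And>z. z \<in> T \<Longrightarrow> dist x y' \<le> dist x z"
    using ex_is_arg_min_if_finite[of T "dist x"] by (auto simp: is_arg_min_linorder)
  have sub: "closed_segment x y' \<subseteq> closed_segment x y"
    using y'(1) by (simp add: T_def subset_closed_segment)
  have "z = x \<or> z = y'" if z: "z \<in> closed_segment x y'" "z \<in> integer_points" for z
  proof (rule ccontr)
    assume *: "\<not> (z = x \<or> z = y')"
    then have "z \<in> T" using z sub by (auto simp: T_def)
    then have le: "dist x y' \<le> dist x z" by (rule y')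
    have "dist x y' = dist x z + dist z y'"
      using z(1) by (simp add: between_mem_segment[symmetric] between)
    with le * show False by simp
  qed
  then have "primitive_segment (closed_segment x y')"
    unfolding primitive_segment_def using assms y'(1) unfolding T_def
    by (intro exI[of _ x] exI[of _ y']) auto
  then show ?thesis using sub that by blast
qed

lemma bounded_lattice_polytope: "lattice_polytope P \<Longrightarrow> bounded P"
  by (auto simp: lattice_polytope_def finite_imp_bounded bounded_convex_hull)

lemma convex_lattice_polytope: "lattice_polytope P \<Longrightarrow> convex P"
  by (auto simp: lattice_polytope_def)

text \<open>Choosing in every segment the endpoint with the larger or the smaller \<open>k\<close>-th coordinate
  yields two points of \<open>P\<close> whose \<open>k\<close>-th coordinates differ by the sum of all the \<open>k\<close>-th extents.\<close>

lemma finite_segment_decompositions: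
  fixes P :: "(real ^ 'n) set"
  assumes "bounded P"
  shows "finite {L. \<exists>E. (\<forall>i\<in>{1..L}. primitive_segment (E i)) \<and> minkowski_sum_in L E P}"
proof -
  obtain c where c: "\<And>x. x \<in> P \<Longrightarrow> norm x \<le> c"
    using assms by (auto simp: bounded_iff)
  have bound: "real L \<le> real CARD('n) * (2 * c)"
    if prim: "\<forall>i\<in>{1..L}. primitive_segment (E i)" and sub: "(\<Sum>i = 1..L. E i) \<subseteq> P"
    for L and E :: "nat \<Rightarrow> (real ^ 'n) set"
  proof -
    have "\<forall>i\<in>{1..L}. \<exists>ab. fst ab \<in> integer_points \<and> snd ab \<in> integer_points \<and> fst ab \<noteq> snd ab \<and>
        E i = closed_segment (fst ab) (snd ab)"
      using prim by (fastforce simp: primitive_segment_def)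
    then obtain ab where ab: "\<And>i. i \<in> {1..L} \<Longrightarrow> fst (ab i) \<in> integer_points \<and>
        snd (ab i) \<in> integer_points \<and> fst (ab i) \<noteq> snd (ab i) \<and>
        E i = closed_segment (fst (ab i)) (snd (ab i))"
      by metis
    define d where "d i = fst (ab i) - snd (ab i)" for i
    have extent: "(\<Sum>i = 1..L. \<bar>d i $ k\<bar>) \<le> 2 * c" for k
    proof -
      define hi where "hi i = (if snd (ab i) $ k \<le> fst (ab i) $ k then fst (ab i) else snd (ab i))" for i
      define lo where "lo i = (if snd (ab i) $ k \<le> fst (ab i) $ k then snd (ab i) else fst (ab i))" for i
      have mem: "(\<Sum>i = 1..L. s i) \<in> P" if "\<And>i. i \<in> {1..L} \<Longrightarrow> s i \<in> E i" for s
        using that by (intro subsetD[OF sub]) (auto simp: set_sum_alt)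
      have "(\<Sum>i = 1..L. hi i) \<in> P" "(\<Sum>i = 1..L. lo i) \<in> P"
        by (rule mem; use ab in \<open>simp add: hi_def lo_def\<close>)+
      then have "\<bar>(\<Sum>i = 1..L. hi i) $ k\<bar> \<le> c" "\<bar>(\<Sum>i = 1..L. lo i) $ k\<bar> \<le> c"
        using c component_le_norm_cart order_trans by blast+
      moreover have "(\<Sum>i = 1..L. \<bar>d i $ k\<bar>) = (\<Sum>i = 1..L. hi i) $ k - (\<Sum>i = 1..L. lo i) $ k"
        by (auto simp: sum_subtractf[symmetric] hi_def lo_def d_def intro!: sum.cong)
      ultimately show ?thesis by linarith
    qed
    \<comment> \<open>A nonzero integer vector has l1 norm at least 1, so the extents of all
      segments in all coordinates add up to at least \<open>L\<close>.\<close>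
    have "1 \<le> (\<Sum>k\<in>UNIV. \<bar>d i $ k\<bar>)" if i: "i \<in> {1..L}" for i
    proof -
      obtain k where "d i $ k \<noteq> 0"
        using ab[OF i] by (auto simp: d_def vec_eq_iff)
      moreover have "d i $ k \<in> \<int>"
        using ab[OF i] by (auto simp: d_def integer_points_def)
      ultimately have "1 \<le> \<bar>d i $ k\<bar>" by (rule Ints_nonzero_abs_ge1[rotated])
      also have "\<dots> \<le> (\<Sum>k\<in>UNIV. \<bar>d i $ k\<bar>)" by (rule member_le_sum) auto
      finally show ?thesis .
    qed
    then have "real L \<le> (\<Sum>i = 1..L. \<Sum>k\<in>UNIV. \<bar>d i $ k\<bar>)"
      using sum_mono[of "{1..L}" "\<lambda>_. 1::real"] by force
    also have "\<dots> = (\<Sum>k\<in>UNIV. \<Sum>i = 1..L. \<bar>d i $ k\<bar>)" by (rule sum.swap)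
    also have "\<dots> \<le> real CARD('n) * (2 * c)" using extent by (intro sum_bounded_above) auto
    finally show ?thesis .
  qed
  have "{L. \<exists>E. (\<forall>i\<in>{1..L}. primitive_segment (E i)) \<and> minkowski_sum_in L E P}
      \<subseteq> {..nat \<lceil>real CARD('n) * (2 * c)\<rceil>}"
  proof safe
    fix L and E :: "nat \<Rightarrow> (real ^ 'n) set"
    assume E: "\<forall>i\<in>{1..L}. primitive_segment (E i)" "minkowski_sum_in L E P"
    show "L \<le> nat \<lceil>real CARD('n) * (2 * c)\<rceil>"
    proof (cases "L = 0")
      case False
      then have "real L \<le> real CARD('n) * (2 * c)"
        using E bound[of L E] by (simp add: minkowski_sum_in_def)
      then show ?thesis by linarith
    qed simp
  qed
  then show ?thesis by (rule finite_subset) simp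
qed

section \<open>Zonotopes excluded by a maximal decomposition\<close>

lemma sum_list_set_mono:
  fixes Es Fs :: "'a :: comm_monoid_add set list"
  shows "list_all2 (\<subseteq>) Es Fs \<Longrightarrow> sum_list Es \<subseteq> sum_list Fs"
proof (induction rule: list_all2_induct)
  case (Cons E Es F Fs)
  then show ?case by (simp add: set_plus_mono2)
qed simp

definition has_two_integer_points :: "(real ^ 'n) set \<Rightarrow> bool"
  where "has_two_integer_points F \<longleftrightarrow> (\<exists>x\<in>F \<inter> integer_points. \<exists>y\<in>F \<inter> integer_points. x \<noteq> y)"

text \<open>Each set of the list contains a primitive segment, and shrinking the sets shrinks their
  sum. The list may thus mix segments with summands of a decomposition.\<close>

lemma length_le_minkowski_length:
  assumes P: "bounded P"
    and Fs: "\<And>F. F \<in> set Fs \<Longrightarrow> convex F \<and> has_two_integer_points F"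
    and sub: "sum_list Fs \<subseteq> P"
  shows "length Fs \<le> minkowski_length P"
proof -
  have "\<exists>E. primitive_segment E \<and> E \<subseteq> F" if F: "F \<in> set Fs" for F
  proof -
    obtain x y where xy: "x \<in> F \<inter> integer_points" "y \<in> F \<inter> integer_points" "x \<noteq> y"
      using Fs[OF F] by (auto simp: has_two_integer_points_def)
    then obtain E where "primitive_segment E" "E \<subseteq> closed_segment x y"
      using primitive_segment_in_segment[of x y] by auto
    moreover have "closed_segment x y \<subseteq> F"
      using xy Fs[OF F] by (intro closed_segment_subset) auto
    ultimately show ?thesis by blast
  qed
  then obtain pr where pr: "\<And>F. F \<in> set Fs \<Longrightarrow> primitive_segment (pr F) \<and> pr F \<subseteq> F"
    by metis
  define E where "E i = pr (Fs ! (i - 1))" for i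
  have "(\<Sum>i = 1..length Fs. E i) = (\<Sum>i = 0..<length Fs. E (Suc i))"
    by (simp add: sum.atLeast1_atMost_eq atLeast0LessThan)
  also have "\<dots> = sum_list (map pr Fs)"
    by (simp add: sum_list_sum_nth E_def)
  also have "\<dots> \<subseteq> sum_list Fs"
    using pr by (intro sum_list_set_mono) (auto simp: list_all2_conv_all_nth)
  finally have "minkowski_sum_in (length Fs) E P"
    using sub by (auto simp: minkowski_sum_in_def)
  moreover have "\<forall>i\<in>{1..length Fs}. primitive_segment (E i)"
    using pr by (auto simp: E_def)
  ultimately have "length Fs \<in> {L. \<exists>E. (\<forall>i\<in>{1..L}. primitive_segment (E i)) \<and> minkowski_sum_in L E P}"
    by auto
  then show ?thesis
    unfolding minkowski_length_def by (rule Max_ge[OF finite_segment_decompositions[OF P]])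
qed

text \<open>The subsequences of \<open>xs\<close> give the subset sums of the generators, among
  which are all vertices of the zonotope. Induction on the generators: if \<open>s1\<close> is a
  point of the first segment, convexity carries the hypothesis for \<open>p\<close> over to the base
  point \<open>p + s1\<close> and the remaining generators.\<close>

lemma zonotope_subset:
  fixes C :: "'a :: real_vector set"
  assumes "convex C" "\<And>ys. ys \<in> set (subseqs xs) \<Longrightarrow> p + sum_list ys \<in> C"
    and "s \<in> sum_list (map (closed_segment 0) xs)"
  shows "p + s \<in> C"
  using assms(2,3)
proof (induction xs arbitrary: p s)
  case Nil
  then show ?case by (simp add: set_zero)
next
  case (Cons x xs)
  from Cons.prems(2) obtain s1 s2 where s: "s = s1 + s2" "s1 \<in> closed_segment 0 x"
      "s2 \<in> sum_list (map (closed_segment 0) xs)"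
    by (auto elim: set_plus_elim)
  then obtain \<theta> where \<theta>: "s1 = \<theta> *\<^sub>R x" "0 \<le> \<theta>" "\<theta> \<le> 1"
    by (auto simp: in_segment)
  have "(p + s1) + sum_list ys \<in> C" if ys: "ys \<in> set (subseqs xs)" for ys
  proof -
    have "p + sum_list ys \<in> C" "p + sum_list (x # ys) \<in> C"
      using ys by (auto intro!: Cons.prems(1) simp: Let_def simp del: sum_list.Cons)
    then have "(1 - \<theta>) *\<^sub>R (p + sum_list ys) + \<theta> *\<^sub>R (p + sum_list (x # ys)) \<in> C"
      using \<theta> \<open>convex C\<close> by (intro convexD) auto
    then show ?thesis by (simp add: \<theta> algebra_simps)
  qed
  from Cons.IH[OF this s(3)] show ?case by (simp add: s(1) add.assoc)
qed

lemma nontrivial_lattice_polytope_has_two: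
  assumes "nontrivial_lattice_polytope F"
  shows "has_two_integer_points F"
proof -
  obtain S where S: "finite S" "S \<noteq> {}" "S \<subseteq> integer_points" "F = convex hull S"
    using assms by (auto simp: nontrivial_lattice_polytope_def lattice_polytope_def)
  obtain a where a: "a \<in> S" using S by blast
  have "S \<noteq> {a}" using assms S by (auto simp: nontrivial_lattice_polytope_def)
  then obtain b where "b \<in> S" "b \<noteq> a" using a by blast
  then show ?thesis
    using a S hull_subset[of S convex] unfolding has_two_integer_points_def by blast
qed

lemma convex_set_sum: "(\<And>i. i \<in> I \<Longrightarrow> convex (Q i)) \<Longrightarrow> convex (\<Sum>i\<in>I. Q i)"
  by (induction I rule: infinite_finite_induct) (auto intro: convex_set_plus simp: set_zero)

text \<open>Otherwise the summands indexed by \<open>J\<close> could be exchanged for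
  \<open>card J + 1\<close> lattice segments, and \<open>P\<close> would contain a sum of
  \<open>N + 1\<close> nontrivial sets.\<close>

lemma maximal_decomposition_no_zonotope:
  assumes P: "lattice_polytope P" and dec: "maximal_decomposition P N Q"
    and J: "J \<subseteq> {1..N}" "J \<noteq> {}" and p: "p \<in> integer_points"
    and xs: "length xs = Suc (card J)" "set xs \<subseteq> integer_points - {0}"
    and zon: "\<And>ys. ys \<in> set (subseqs xs) \<Longrightarrow> p + sum_list ys \<in> (\<Sum>i\<in>J. Q i)"
  shows False
proof -
  obtain x xs' where x: "xs = x # xs'" using xs by (cases xs) auto
  have Q: "nontrivial_lattice_polytope (Q i)" if "i \<in> {1..N}" for i
    using dec that by (auto simp: maximal_decomposition_def)
  have cQ: "convex (Q i)" if "i \<in> {1..N}" for i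
    using Q[OF that] convex_lattice_polytope by (auto simp: nontrivial_lattice_polytope_def)
  have finJ: "finite J" using J finite_subset by blast
  have "N \<noteq> 0" using J by auto
  then have subP: "(\<Sum>i = 1..N. Q i) \<subseteq> P"
    using dec by (auto simp: maximal_decomposition_def minkowski_sum_in_def)
  define R where "R = map Q (sorted_list_of_set ({1..N} - J))"
  \<comment> \<open>The translation by \<open>p\<close> is absorbed into the first segment; as a
    list entry of its own, \<open>{p}\<close> would not contain two lattice points.\<close>
  define Fs where "Fs = ({p} + closed_segment 0 x) # map (closed_segment 0) xs' @ R"
  have R: "sum_list R = (\<Sum>i\<in>{1..N} - J. Q i)"
    unfolding R_def by (subst sum_list_distinct_conv_sum_set) auto
  have "{p} + sum_list (map (closed_segment 0) xs) \<subseteq> (\<Sum>i\<in>J. Q i)"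
  proof
    fix z assume "z \<in> {p} + sum_list (map (closed_segment 0) xs)"
    then obtain s where "z = p + s" "s \<in> sum_list (map (closed_segment 0) xs)"
      by (auto elim: set_plus_elim)
    moreover have "convex (\<Sum>i\<in>J. Q i)"
      using cQ J(1) by (intro convex_set_sum) blast
    ultimately show "z \<in> (\<Sum>i\<in>J. Q i)"
      using zonotope_subset[OF _ zon] by simp
  qed
  then have "({p} + sum_list (map (closed_segment 0) xs)) + sum_list R \<subseteq>
      (\<Sum>i\<in>J. Q i) + (\<Sum>i\<in>{1..N} - J. Q i)"
    unfolding R by (rule set_plus_mono2) simp
  also have "\<dots> = (\<Sum>i = 1..N. Q i)"
    using sum.subset_diff[OF J(1), of Q] by (simp add: add.commute)
  finally have "sum_list Fs \<subseteq> P"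
    using subP by (simp add: Fs_def x add.assoc)
  moreover have "convex F \<and> has_two_integer_points F" if F: "F \<in> set Fs" for F
  proof -
    consider "F = {p} + closed_segment 0 x" | y where "y \<in> set xs'" "F = closed_segment 0 y"
      | i where "i \<in> {1..N}" "F = Q i"
      using F unfolding Fs_def R_def by auto
    then show ?thesis
    proof cases
      case 1
      have "p + 0 \<in> F" "p + x \<in> F" unfolding 1 by (intro set_plus_intro; simp)+
      moreover have "x \<noteq> 0" "p + x \<in> integer_points"
        using xs p x by (auto simp: integer_points_def)
      ultimately have "has_two_integer_points F"
        using p unfolding has_two_integer_points_def by (intro bexI[of _ p] bexI[of _ "p + x"]) auto
      moreover have "convex F" unfolding 1 by (intro convex_set_plus) auto
      ultimately show ?thesis by blast
    next
      case 2
      then have "has_two_integer_points F"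
        using xs x unfolding has_two_integer_points_def
        by (intro bexI[of _ 0] bexI[of _ y]) (auto simp: integer_points_def)
      then show ?thesis using 2 by simp
    next
      case 3
      then show ?thesis using Q[OF 3(1)] cQ[OF 3(1)] nontrivial_lattice_polytope_has_two by simp
    qed
  qed
  ultimately have "length Fs \<le> minkowski_length P"
    by (intro length_le_minkowski_length bounded_lattice_polytope P)
  moreover have "length Fs = Suc N"
    using xs x finJ J card_mono[OF _ J(1)] by (simp add: Fs_def R_def card_Diff_subset)
  ultimately show False using dec by (simp add: maximal_decomposition_def)
qed

section \<open>Pairs of point sets modulo 3\<close>

definition cong_vec :: "int \<Rightarrow> int ^ 'n \<Rightarrow> int ^ 'n \<Rightarrow> bool"
  where "cong_vec m x y \<longleftrightarrow> (\<forall>i. m dvd x $ i - y $ i)"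

lemma cong_vec_commute: "cong_vec m x y \<longleftrightarrow> cong_vec m y x"
  by (simp add: cong_vec_def dvd_diff_commute)

text \<open>The pigeons are the indices in \<open>X\<close>, not their values under
  \<open>f\<close>, so that in \<open>plane_pigeonhole\<close> a coincidence of two values also
  counts as a collision.\<close>

lemma cong_vec_pigeonhole:
  fixes f :: "'a \<Rightarrow> int ^ 'n"
  assumes "finite X" "0 < m" "nat m ^ CARD('n) < card X"
  obtains x y where "x \<in> X" "y \<in> X" "x \<noteq> y" "cong_vec m (f x) (f y)"
proof -
  define g where "g x = (\<lambda>i. f x $ i mod m)" for x
  have fin: "finite (PiE (UNIV :: 'n set) (\<lambda>_. {0..<m}))"
    by (intro finite_PiE) auto
  have "g ` X \<subseteq> PiE (UNIV :: 'n set) (\<lambda>_. {0..<m})"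
    using assms by (auto simp: g_def)
  then have "card (g ` X) \<le> card (PiE (UNIV :: 'n set) (\<lambda>_. {0..<m}))"
    by (rule card_mono[OF fin])
  also have "\<dots> = nat m ^ CARD('n)" by (simp add: card_PiE)
  finally have "\<not> inj_on g X" using assms by (intro pigeonhole) simp
  then obtain x y where "x \<in> X" "y \<in> X" "x \<noteq> y" "g x = g y"
    by (auto simp: inj_on_def)
  moreover from this have "cong_vec m (f x) (f y)"
    by (auto simp: cong_vec_def g_def mod_eq_dvd_iff fun_eq_iff)
  ultimately show ?thesis using that by blast
qed

text \<open>The translates of the nine combinations of \<open>u\<close> and \<open>v\<close> by the points of \<open>B\<close> number at least
  36, whereas there are only 27 residue classes.\<close>

lemma plane_pigeonhole:
  fixes u v :: "int ^ 3"
  assumes B: "finite B" "4 \<le> card B"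
    and incong: "\<And>b b'. b \<in> B \<Longrightarrow> b' \<in> B \<Longrightarrow> cong_vec 3 b b' \<Longrightarrow> b = b'"
    and uv: "\<not> cong_vec 3 u 0" "\<not> cong_vec 3 v 0" "\<not> cong_vec 3 u v" "\<not> cong_vec 3 u (- v)"
  obtains b b' where "b \<in> B" "b' \<in> B"
    "cong_vec 3 (b - b') u \<or> cong_vec 3 (b - b') v \<or> cong_vec 3 (b - b') (u + v) \<or>
     cong_vec 3 (b - b') (u - v)"
proof -
  define X where "X = B \<times> {0, 1, 2 :: int} \<times> {0, 1, 2 :: int}"
  define f where "f = (\<lambda>(b, i, j). b + i *s u + j *s v)"
  have "finite X" "(0 :: int) < 3" "nat 3 ^ CARD(3) < card X"
    using B by (simp_all add: X_def)
  then obtain x y where "x \<in> X" "y \<in> X" "x \<noteq> y" and cong: "cong_vec 3 (f x) (f y)"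
    by (rule cong_vec_pigeonhole[where f = f])
  obtain b i j where x: "x = (b, i, j)" by (rule prod_cases3)
  obtain b' i' j' where y: "y = (b', i', j')" by (rule prod_cases3)
  have neq: "(b, i, j) \<noteq> (b', i', j')" using \<open>x \<noteq> y\<close> by (simp add: x y)
  have mem: "b \<in> B" "b' \<in> B" "i \<in> {0, 1, 2}" "j \<in> {0, 1, 2}" "i' \<in> {0, 1, 2}" "j' \<in> {0, 1, 2}"
    using \<open>x \<in> X\<close> \<open>y \<in> X\<close> by (simp_all only: X_def x y mem_Sigma_iff)
  \<comment> \<open>The collision gives \<open>b - b'\<close> congruent to
    \<open>(i' - i) *s u + (j' - j) *s v\<close>; both coefficients are now reduced to -1, 0 or
    1.\<close>
  have balanced: "\<exists>e\<in>{-1, 0, 1}. 3 dvd e - k" for k :: int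
  proof -
    have "3 dvd -1 - k \<or> 3 dvd 0 - k \<or> 3 dvd 1 - k" by presburger
    then show ?thesis by blast
  qed
  obtain e where e: "e \<in> {-1, 0, 1}" "3 dvd e - (i' - i)"
    using balanced by blast
  obtain g where g: "g \<in> {-1, 0, 1}" "3 dvd g - (j' - j)"
    using balanced by blast
  have c: "cong_vec 3 (b - b') (e *s u + g *s v)"
    unfolding cong_vec_def
  proof
    fix k
    have "3 dvd (f x - f y) $ k" using cong by (simp add: cong_vec_def)
    then have "3 dvd (f x - f y) $ k - (e - (i' - i)) * u $ k - (g - (j' - j)) * v $ k"
      by (rule dvd_diff[OF dvd_diff[OF _ dvd_mult2[OF e(2)]] dvd_mult2[OF g(2)]])
    also have "(f x - f y) $ k - (e - (i' - i)) * u $ k - (g - (j' - j)) * v $ k =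
        (b - b') $ k - (e *s u + g *s v) $ k"
      by (simp add: f_def x y algebra_simps)
    finally show "3 dvd (b - b') $ k - (e *s u + g *s v) $ k" .
  qed
  \<comment> \<open>The hypotheses \<open>uv\<close> say that \<open>u\<close> and \<open>v\<close>
    are linearly independent mod 3. Hence a collision with \<open>b = b'\<close> would be
    trivial.\<close>
  have indep: "e = 0 \<and> g = 0" if "b = b'"
  proof -
    have h: "3 dvd e * u $ k + g * v $ k" for k
    proof -
      have "3 dvd 0 - (e * u $ k + g * v $ k)"
        using c that by (simp add: cong_vec_def)
      then show ?thesis by presburger
    qed
    obtain k1 k2 k3 k4 where k: "\<not> 3 dvd u $ k1" "\<not> 3 dvd v $ k2" "\<not> 3 dvd u $ k3 - v $ k3"
      "\<not> 3 dvd u $ k4 + v $ k4"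
      using uv by (auto simp: cong_vec_def)
    consider "e = 0" "g = 0" | "e = 0" "g = 1 \<or> g = -1" | "g = 0" "e = 1 \<or> e = -1"
      | "e = g" "g = 1 \<or> g = -1" | "e = - g" "g = 1 \<or> g = -1"
      using e(1) g(1) by auto
    then show ?thesis
    proof cases
      case 2
      then show ?thesis using h[of k2] k by auto
    next
      case 3
      then show ?thesis using h[of k1] k by auto
    next
      case 4
      then show ?thesis using h[of k4] k(4) by (elim disjE; simp; presburger)
    next
      case 5
      then show ?thesis using h[of k3] k(3) by (elim disjE; simp; presburger)
    qed simp
  qed
  have "b \<noteq> b'"
  proof
    assume "b = b'"
    with indep e(2) g(2) have "3 dvd i' - i" "3 dvd j' - j" by (auto simp: dvd_diff_commute)
    then have "i = i'" "j = j'" using mem by auto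
    then show False using neq \<open>b = b'\<close> by simp
  qed
  then have "\<not> cong_vec 3 (b - b') 0"
    using incong mem by (auto simp: cong_vec_def)
  \<comment> \<open>Up to sign there are four nonzero combinations of \<open>u\<close> and
    \<open>v\<close>; exchanging \<open>b\<close> and \<open>b'\<close> takes care of the
    sign.\<close>
  have swap: "cong_vec 3 (b' - b) (- w)" if "cong_vec 3 (b - b') w" for w
    unfolding cong_vec_def
  proof
    fix k
    have "3 dvd - ((b - b') $ k - w $ k)" using that unfolding cong_vec_def dvd_minus_iff by blast
    then show "3 dvd (b' - b) $ k - (- w) $ k" by (simp add: algebra_simps)
  qed
  consider "cong_vec 3 (b - b') u" | "cong_vec 3 (b - b') v" | "cong_vec 3 (b - b') (u + v)"
    | "cong_vec 3 (b - b') (u - v)" | "cong_vec 3 (b' - b) u" | "cong_vec 3 (b' - b) v"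
    | "cong_vec 3 (b' - b) (u + v)" | "cong_vec 3 (b' - b) (u - v)"
    using e(1) g(1) c swap[OF c] \<open>\<not> cong_vec 3 (b - b') 0\<close> by (auto simp: vector_sneg_minus1[symmetric])
  then show ?thesis using that mem by cases blast+
qed

text \<open>In the application \<open>A\<close> and \<open>B\<close> are the sets of lattice points of two summands.\<close>

locale tight_pair =
  fixes A B :: "(int ^ 3) set"
  assumes finite_A: "finite A" and finite_B: "finite B"
    and card_A: "5 \<le> card A" and card_B: "5 \<le> card B"
    and cong_imp_eq: "\<lbrakk>a \<in> A; a' \<in> A; b \<in> B; b' \<in> B; cong_vec 3 (a - a') (b - b')\<rbrakk> \<Longrightarrow> a - a' = b - b'"
    and sidon_A: "\<lbrakk>a \<in> A; a' \<in> A; c \<in> A; c' \<in> A; a \<noteq> a'; a - a' = c - c'\<rbrakk> \<Longrightarrow> a = c"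
    and sidon_B: "\<lbrakk>b \<in> B; b' \<in> B; c \<in> B; c' \<in> B; b \<noteq> b'; b - b' = c - c'\<rbrakk> \<Longrightarrow> b = c"
    and common_offset: "\<lbrakk>a \<in> A; a' \<in> A; b \<in> B; b' \<in> B; a \<noteq> a'; a - a' = b - b';
        c \<in> A; c' \<in> A; d \<in> B; d' \<in> B; c \<noteq> c'; c - c' = d - d'\<rbrakk> \<Longrightarrow> a - b = c - d"
begin

text \<open>The assumptions are symmetric, so whatever is shown for \<open>A\<close> is available
  for \<open>B\<close> as well.\<close>

lemma tight_pair_swap: "tight_pair B A"
proof
  show "b - b' = a - a'" if "b \<in> B" "b' \<in> B" "a \<in> A" "a' \<in> A" "cong_vec 3 (b - b') (a - a')"
    for a a' b b'
  proof -
    have "cong_vec 3 (a - a') (b - b')"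
      using that(5) by (simp add: cong_vec_def dvd_diff_commute)
    then show ?thesis using cong_imp_eq that by metis
  qed
  show "b - a = d - c"
    if "b \<in> B" "b' \<in> B" "a \<in> A" "a' \<in> A" "b \<noteq> b'" "b - b' = a - a'"
      "d \<in> B" "d' \<in> B" "c \<in> A" "c' \<in> A" "d \<noteq> d'" "d - d' = c - c'" for a a' b b' c c' d d'
    using common_offset[of a a' b b' c c' d d'] that by (metis minus_diff_eq right_minus_eq)
qed (fact finite_A finite_B card_A card_B sidon_A sidon_B)+

text \<open>Compare with the zero difference \<open>a - a\<close> of any point of
  \<open>A\<close>.\<close>

lemma incong_B:
  assumes "b \<in> B" "b' \<in> B" "cong_vec 3 b b'" shows "b = b'"
proof -
  obtain a where "a \<in> A" using card_A by fastforce
  then have "a - a = b - b'"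
    using assms by (intro cong_imp_eq) (auto simp: cong_vec_def dvd_diff_commute)
  then show ?thesis by simp
qed

lemma incong_A:
  assumes "a \<in> A" "a' \<in> A" "cong_vec 3 a a'" shows "a = a'"
  using tight_pair.incong_B[OF tight_pair_swap] assms .

text \<open>A residue class that contains differences of \<open>A\<close> with two different
  minuends is avoided by \<open>B\<close>: a difference of \<open>B\<close> in this class would
  equal both of them, against the Sidon property of \<open>A\<close>.\<close>

lemma forbidden_difference:
  assumes "a \<in> A" "a' \<in> A" "c \<in> A" "c' \<in> A" "a \<noteq> a'" "a \<noteq> c" "cong_vec 3 (a - a') (c - c')"
    and "b \<in> B" "b' \<in> B"
  shows "\<not> cong_vec 3 (b - b') (a - a')"
proof
  assume *: "cong_vec 3 (b - b') (a - a')"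
  have "cong_vec 3 (a - a') (b - b')"
    using * by (simp add: cong_vec_def dvd_diff_commute)
  moreover have "cong_vec 3 (c - c') (b - b')"
    unfolding cong_vec_def
  proof
    fix k
    have "3 dvd (b - b') $ k - (a - a') $ k" "3 dvd (a - a') $ k - (c - c') $ k"
      using * assms(7) by (auto simp: cong_vec_def)
    then show "3 dvd (c - c') $ k - (b - b') $ k" by presburger
  qed
  ultimately have "a - a' = b - b'" "c - c' = b - b'"
    using assms cong_imp_eq by blast+
  then show False using sidon_A[of a a' c c'] assms by simp
qed

text \<open>Suppose \<open>r\<close>, \<open>p\<close>, \<open>q\<close> lie on a line mod 3, and
  let \<open>d\<close> be a fourth point of \<open>A\<close>. In the plane mod 3 through these
  points the direction of the line is forbidden to \<open>B\<close>, and the other three directions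
  are those of \<open>d - p\<close>, \<open>d - q\<close> and \<open>d - r\<close>. So four points
  of \<open>B\<close> always have one of these three as a difference, and the common minuend
  \<open>d\<close> determines the minuend in \<open>B\<close> through the common offset.\<close>

lemma no_collinear_triple:
  assumes pqr: "p \<in> A" "q \<in> A" "r \<in> A" "p \<noteq> q" "r \<noteq> p" "r \<noteq> q"
  shows "\<not> cong_vec 3 (q - p) (p - r)"
proof
  assume col: "cong_vec 3 (q - p) (p - r)"
  then have col': "3 dvd q $ k - p $ k - (p $ k - r $ k)" for k
    by (simp add: cong_vec_def)
  have "card {p, q, r} < card A"
    using card_A card_insert_le_m1[of 3 "{q, r}" p] card_insert_le_m1[of 2 "{r}" q] by simp
  then obtain d where d: "d \<in> A" "d \<noteq> p" "d \<noteq> q" "d \<noteq> r"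
    using card_mono[of "{p, q, r}" A] by fastforce
  define u v where "u = q - p" and "v = d - p"
  have uv: "\<not> cong_vec 3 u 0" "\<not> cong_vec 3 v 0" "\<not> cong_vec 3 u v" "\<not> cong_vec 3 u (- v)"
  proof -
    show "\<not> cong_vec 3 u 0" "\<not> cong_vec 3 v 0" "\<not> cong_vec 3 u v"
      using incong_A[of q p] incong_A[of d p] incong_A[of q d] pqr d
      by (auto simp: u_def v_def cong_vec_def)
    show "\<not> cong_vec 3 u (- v)"
    proof
      assume *: "cong_vec 3 u (- v)"
      have "cong_vec 3 d r" unfolding cong_vec_def
      proof
        fix k
        have "3 dvd q $ k - p $ k - - (d $ k - p $ k)"
          using * by (simp add: cong_vec_def u_def v_def)
        with col'[of k] show "3 dvd d $ k - r $ k" by presburger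
      qed
      then show False using incong_A d pqr by blast
    qed
  qed
  \<comment> \<open>Stated for subsets \<open>B'\<close> because it is used twice: for
    \<open>B\<close>, and again for \<open>B\<close> without the minuend \<open>x\<close> found
    first. The second use yields a different minuend with the same offset from
    \<open>d\<close>.\<close>
  have ex: "\<exists>x\<in>B'. \<exists>y\<in>B'. \<exists>l\<in>{p, q, r}. x - y = d - l" if B': "B' \<subseteq> B" "4 \<le> card B'" for B'
  proof -
    have inc: "x = y" if "x \<in> B'" "y \<in> B'" "cong_vec 3 x y" for x y
      using that incong_B B'(1) by blast
    have "finite B'" using B' finite_B finite_subset by blast
    then obtain b b' where b: "b \<in> B'" "b' \<in> B'" and
      cases: "cong_vec 3 (b - b') u \<or> cong_vec 3 (b - b') v \<or> cong_vec 3 (b - b') (u + v) \<or>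
        cong_vec 3 (b - b') (u - v)"
      by (rule plane_pigeonhole[OF _ B'(2) inc uv])
    have bB: "b \<in> B" "b' \<in> B" using b B' by auto
    have "\<not> cong_vec 3 (b - b') u"
      unfolding u_def using forbidden_difference[of q p p r] pqr col bB by blast
    moreover have "b - b' = d - p" if "cong_vec 3 (b - b') v"
      using that cong_imp_eq[of d p b b'] pqr d bB by (simp add: v_def cong_vec_def dvd_diff_commute)
    moreover have "b - b' = d - r" if *: "cong_vec 3 (b - b') (u + v)"
    proof -
      have "cong_vec 3 (d - r) (b - b')" unfolding cong_vec_def
      proof
        fix k
        have "3 dvd b $ k - b' $ k - (q $ k - p $ k + (d $ k - p $ k))"
          using * by (simp add: cong_vec_def u_def v_def)
        with col'[of k] show "3 dvd (d - r) $ k - (b - b') $ k"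
          unfolding vector_minus_component by presburger
      qed
      then show ?thesis using cong_imp_eq[of d r b b'] pqr d bB by simp
    qed
    moreover have "b' - b = d - q" if *: "cong_vec 3 (b - b') (u - v)"
    proof -
      have "cong_vec 3 (d - q) (b' - b)" unfolding cong_vec_def
      proof
        fix k
        have "3 dvd b $ k - b' $ k - (q $ k - p $ k - (d $ k - p $ k))"
          using * by (simp add: cong_vec_def u_def v_def)
        then show "3 dvd (d - q) $ k - (b' - b) $ k"
          unfolding vector_minus_component by presburger
      qed
      then show ?thesis using cong_imp_eq[of d q b' b] pqr d bB by simp
    qed
    ultimately show ?thesis using cases b by blast
  qed
  obtain x y l where x: "x \<in> B" "y \<in> B" "l \<in> {p, q, r}" "x - y = d - l"
    using ex[of B] card_B by auto
  have "4 \<le> card (B - {x})" using card_B x finite_B by simp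
  then obtain x' y' l' where x': "x' \<in> B - {x}" "y' \<in> B - {x}" "l' \<in> {p, q, r}" "x' - y' = d - l'"
    using ex[of "B - {x}"] by blast
  have "d - x = d - x'"
    using common_offset[of d l x y d l' x' y'] x x' pqr d by auto
  then show False using x' by simp
qed

text \<open>Mod 3 the points form a parallelogram with sides \<open>r - p\<close> and
  \<open>s - p\<close> and diagonals \<open>q - p\<close> and \<open>r - s\<close>. Opposite sides
  are congruent, so both side directions are forbidden to \<open>B\<close>, and any four points of
  \<open>B\<close> have a diagonal as a difference. As before this gives two differences of
  \<open>B\<close> with distinct minuends.\<close>

lemma no_parallelogram:
  assumes pqrs: "p \<in> A" "q \<in> A" "r \<in> A" "s \<in> A" "distinct [p, q, r, s]"
  shows "\<not> cong_vec 3 (r - p) (q - s)"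
proof
  assume par: "cong_vec 3 (r - p) (q - s)"
  then have par': "3 dvd r $ k - p $ k - (q $ k - s $ k)" for k
    by (simp add: cong_vec_def)
  have par2: "cong_vec 3 (s - p) (q - r)"
    unfolding cong_vec_def vector_minus_component
  proof
    fix k show "3 dvd s $ k - p $ k - (q $ k - r $ k)" using par'[of k] by presburger
  qed
  define u v where "u = r - p" and "v = s - p"
  have uv: "\<not> cong_vec 3 u 0" "\<not> cong_vec 3 v 0" "\<not> cong_vec 3 u v" "\<not> cong_vec 3 u (- v)"
  proof -
    show "\<not> cong_vec 3 u 0" "\<not> cong_vec 3 v 0" "\<not> cong_vec 3 u v"
      using incong_A[of r p] incong_A[of s p] incong_A[of r s] pqrs
      by (auto simp: u_def v_def cong_vec_def)
    show "\<not> cong_vec 3 u (- v)"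
    proof
      assume *: "cong_vec 3 u (- v)"
      have "cong_vec 3 p q" unfolding cong_vec_def
      proof
        fix k
        have "3 dvd r $ k - p $ k - - (s $ k - p $ k)"
          using * by (simp add: cong_vec_def u_def v_def)
        with par'[of k] show "3 dvd p $ k - q $ k" by presburger
      qed
      then show False using incong_A pqrs by auto
    qed
  qed
  have ex: "\<exists>x\<in>B'. \<exists>y\<in>B'. x - y = q - p \<or> x - y = r - s" if B': "B' \<subseteq> B" "4 \<le> card B'" for B'
  proof -
    have inc: "x = y" if "x \<in> B'" "y \<in> B'" "cong_vec 3 x y" for x y
      using that incong_B B'(1) by blast
    have "finite B'" using B' finite_B finite_subset by blast
    then obtain b b' where b: "b \<in> B'" "b' \<in> B'" and
      cases: "cong_vec 3 (b - b') u \<or> cong_vec 3 (b - b') v \<or> cong_vec 3 (b - b') (u + v) \<or>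
        cong_vec 3 (b - b') (u - v)"
      by (rule plane_pigeonhole[OF _ B'(2) inc uv])
    have bB: "b \<in> B" "b' \<in> B" using b B' by auto
    have "\<not> cong_vec 3 (b - b') u" "\<not> cong_vec 3 (b - b') v"
      unfolding u_def v_def
      using forbidden_difference[of r p q s] forbidden_difference[of s p q r] pqrs par par2 bB by auto
    moreover have "b - b' = q - p" if *: "cong_vec 3 (b - b') (u + v)"
    proof -
      have "cong_vec 3 (q - p) (b - b')" unfolding cong_vec_def
      proof
        fix k
        have "3 dvd b $ k - b' $ k - (r $ k - p $ k + (s $ k - p $ k))"
          using * by (simp add: cong_vec_def u_def v_def)
        with par'[of k] show "3 dvd (q - p) $ k - (b - b') $ k"
          unfolding vector_minus_component by presburger
      qed
      then show ?thesis using cong_imp_eq[of q p b b'] pqrs bB by simp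
    qed
    moreover have "b - b' = r - s" if *: "cong_vec 3 (b - b') (u - v)"
      using that cong_imp_eq[of r s b b'] pqrs bB by (simp add: u_def v_def cong_vec_def dvd_diff_commute)
    ultimately show ?thesis using cases b by blast
  qed
  obtain x y where x: "x \<in> B" "y \<in> B" and xy: "x - y = q - p \<or> x - y = r - s"
    using ex[of B] card_B by auto
  have "4 \<le> card (B - {x})" using card_B x finite_B by simp
  then obtain x' y' where x': "x' \<in> B" "x' \<noteq> x" "y' \<in> B" and xy': "x' - y' = q - p \<or> x' - y' = r - s"
    using ex[of "B - {x}"] by blast
  have neq: "x \<noteq> y" "x' \<noteq> y'" using xy xy' pqrs(5) by auto
  \<comment> \<open>Both diagonals cannot occur: the common offset would make \<open>q - r\<close> a
    difference of \<open>B\<close>, and the congruent side \<open>s - p\<close> would be equal to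
    it, against the Sidon property of \<open>A\<close>. The same diagonal twice contradicts
    \<open>sidon_B\<close>.\<close>
  have False if z: "z \<in> B" "w \<in> B" "z - w = q - p" "z' \<in> B" "w' \<in> B" "z' - w' = r - s" for z w z' w'
  proof -
    have "q - z = r - z'"
      using common_offset[of q p z w r s z' w'] z pqrs by auto
    then have "q - r = z - z'" by (simp add: algebra_simps)
    moreover from this have "s - p = z - z'"
      using cong_imp_eq[of s p z z'] par2 z pqrs by simp
    ultimately show False using sidon_A[of s p q r] pqrs by auto
  qed
  then show False
    using xy xy' x x' sidon_B[of x y x' y'] neq by metis
qed

text \<open>Two pairs with the same minuend or the same subtrahend are settled by
  \<open>incong_A\<close>. If the minuend of one is the subtrahend of the other, three points are
  collinear mod 3, unless the pairs are reversed and 2 times a difference vanishes mod 3. Four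
  distinct points form a parallelogram mod 3.\<close>

lemma difference_cong_inj:
  assumes "a \<in> A" "a' \<in> A" "c \<in> A" "c' \<in> A" "a \<noteq> a'" and cong: "cong_vec 3 (a - a') (c - c')"
  shows "a = c \<and> a' = c'"
proof -
  have cong': "3 dvd a $ k - a' $ k - (c $ k - c' $ k)" for k
    using cong by (simp add: cong_vec_def)
  have ac: "a' = c'" if "a = c"
    using that cong' incong_A[of a' c'] assms by (auto simp: cong_vec_def dvd_diff_commute)
  have ac': "a = c" if "a' = c'"
    using that cong' incong_A[of a c] assms by (auto simp: cong_vec_def)
  have cc: "c \<noteq> c'"
    using cong' incong_A[of a a'] assms by (auto simp: cong_vec_def)
  have 1: "a' \<noteq> c"
  proof
    assume eq: "a' = c"
    have "a \<noteq> c'"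
    proof
      assume "a = c'"
      then have "3 dvd a $ k - a' $ k" for k using cong'[of k] eq by simp presburger
      then show False using incong_A[of a a'] assms by (auto simp: cong_vec_def)
    qed
    then show False using no_collinear_triple[of a' a c'] assms eq cc by auto
  qed
  have 2: "a \<noteq> c'"
  proof
    assume eq: "a = c'"
    then have "cong_vec 3 (a' - a) (a - c)"
      unfolding cong_vec_def vector_minus_component
    proof (intro allI)
      fix k show "3 dvd a' $ k - a $ k - (a $ k - c $ k)" using cong'[of k, folded eq] by presburger
    qed
    then show False using no_collinear_triple[of a a' c] assms eq 1 cc by auto
  qed
  show ?thesis
  proof (rule ccontr)
    assume "\<not> ?thesis"
    then have "distinct [a', c, a, c']" using ac ac' cc 1 2 assms by auto
    then show False using no_parallelogram[of a' c a c'] assms by auto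
  qed
qed

definition differences :: "(int ^ 3) set"
  where "differences = (\<lambda>(a, a'). a - a') ` (A \<times> A - Id)"

lemma difference_incong_0:
  assumes "x \<in> differences" shows "\<not> cong_vec 3 x 0"
proof -
  obtain a a' where "x = a - a'" "a \<in> A" "a' \<in> A" "a \<noteq> a'"
    using assms by (auto simp: differences_def)
  then show ?thesis using incong_A[of a a'] by (auto simp: cong_vec_def)
qed

lemma differences_incong:
  assumes "x \<in> differences" "y \<in> differences" "cong_vec 3 x y" shows "x = y"
proof -
  obtain a a' where a: "x = a - a'" "a \<in> A" "a' \<in> A" "a \<noteq> a'"
    using assms by (auto simp: differences_def)
  obtain c c' where c: "y = c - c'" "c \<in> A" "c' \<in> A"
    using assms by (auto simp: differences_def)
  show ?thesis using difference_cong_inj[of a a' c c'] a c assms(3) by simp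
qed

lemma card_differences: "card differences = card A * card A - card A" and finite_differences: "finite differences"
proof -
  have "inj_on (\<lambda>(a, a'). a - a') (A \<times> A - Id)"
  proof (rule inj_onI)
    fix x y assume "x \<in> A \<times> A - Id" "y \<in> A \<times> A - Id" "(case x of (a, a') \<Rightarrow> a - a') = (case y of (a, a') \<Rightarrow> a - a')"
    moreover from this have "cong_vec 3 (fst x - snd x) (fst y - snd y)"
      by (simp add: cong_vec_def case_prod_beta)
    ultimately show "x = y"
      using difference_cong_inj[of "fst x" "snd x" "fst y" "snd y"] by (auto simp: prod_eq_iff)
  qed
  then have "card differences = card (A \<times> A - Id)"
    unfolding differences_def by (rule card_image)
  also have "A \<times> A - Id = A \<times> A - (\<lambda>a. (a, a)) ` A" by auto
  also have "card \<dots> = card (A \<times> A) - card ((\<lambda>a. (a, a)) ` A)"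
    using finite_A by (intro card_Diff_subset) auto
  also have "\<dots> = card A * card A - card A"
    by (simp add: card_cartesian_product card_image inj_on_def)
  finally show "card differences = card A * card A - card A" .
  show "finite differences" using finite_A by (simp add: differences_def)
qed

end

lemma card_incongruent_le:
  fixes X :: "(int ^ 'n) set"
  assumes "finite X" "0 < m" "\<And>x y. x \<in> X \<Longrightarrow> y \<in> X \<Longrightarrow> cong_vec m x y \<Longrightarrow> x = y"
  shows "card X \<le> nat m ^ CARD('n)"
proof (rule ccontr)
  assume "\<not> ?thesis"
  then have "nat m ^ CARD('n) < card X" by simp
  with assms(1,2) obtain x y where "x \<in> X" "y \<in> X" "x \<noteq> y" "cong_vec m x y"
    by (rule cong_vec_pigeonhole[where f = "\<lambda>x. x"])
  then show False using assms(3) by blast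
qed

section \<open>Counting differences modulo 3\<close>

context tight_pair
begin

interpretation swap: tight_pair B A by (rule tight_pair_swap)

text \<open>Together with 0 the differences of both sets are pairwise incongruent mod 3, so there
  are at most 27 of them: within one set by \<open>differences_incong\<close>, across the sets by
  \<open>cong_imp_eq\<close>.\<close>

lemma card_differences_Un: "card (differences \<union> swap.differences) \<le> 26"
proof -
  let ?D = "differences \<union> swap.differences"
  have zero: "\<not> cong_vec 3 x 0" "\<not> cong_vec 3 0 x" if "x \<in> ?D" for x
    using that difference_incong_0[of x] swap.difference_incong_0[of x] cong_vec_commute[of 3 x 0]
    by auto
  have mixed: "x = y" if xy: "x \<in> differences" "y \<in> swap.differences" "cong_vec 3 x y" for x y
  proof -
    obtain a a' b b' where "x = a - a'" "a \<in> A" "a' \<in> A" "y = b - b'" "b \<in> B" "b' \<in> B"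
      using xy(1,2) unfolding differences_def swap.differences_def by auto
    then show ?thesis using cong_imp_eq xy(3) by simp
  qed
  have "x = y" if xy: "x \<in> ?D" "y \<in> ?D" "cong_vec 3 x y" for x y
  proof -
    have "cong_vec 3 y x" using xy(3) by (simp only: cong_vec_commute)
    then show ?thesis
      using xy differences_incong[of x y] swap.differences_incong[of x y] mixed[of x y] mixed[of y x]
      by blast
  qed
  with zero have incong: "x = y" if "x \<in> insert 0 ?D" "y \<in> insert 0 ?D" "cong_vec 3 x y" for x y
    using that by blast
  have "finite (insert 0 ?D)" using finite_differences swap.finite_differences by simp
  then have "card (insert 0 ?D) \<le> nat 3 ^ CARD(3)"
    by (rule card_incongruent_le[OF _ zero_less_numeral incong])
  moreover have "0 \<notin> ?D" using zero(1)[of 0] by (simp add: cong_vec_def) blast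
  ultimately show ?thesis using finite_differences swap.finite_differences by simp
qed

text \<open>Six points would already have 30 differences.\<close>

lemma card_A_eq: "card A = 5"
proof (rule ccontr)
  assume "card A \<noteq> 5"
  then have "6 * 5 \<le> card A * (card A - 1)" using card_A by (intro mult_le_mono) auto
  also have "\<dots> = card differences" by (simp add: card_differences diff_mult_distrib2)
  also have "\<dots> \<le> card (differences \<union> swap.differences)"
    using finite_differences swap.finite_differences by (intro card_mono) auto
  finally show False using card_differences_Un by simp
qed

text \<open>There are at least 20 + 20 - 26 = 14 common differences, all with the offset of one of
  them. So they are differences of the set \<open>C\<close> of those points of \<open>A\<close> that
  translation by \<open>t\<close> moves into \<open>B\<close>. Four points have only 12 differences,
  hence \<open>C\<close> is all of \<open>A\<close>.\<close>

lemma translates: obtains t where "B = (+) t ` A"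
proof -
  have cardB: "card B = 5" using tight_pair.card_A_eq[OF tight_pair_swap] .
  define E where "E = differences \<inter> swap.differences"
  have "card differences + card swap.differences = card (differences \<union> swap.differences) + card E"
    unfolding E_def using finite_differences swap.finite_differences by (rule card_Un_Int)
  then have E: "14 \<le> card E"
    using card_differences_Un by (simp add: card_differences swap.card_differences card_A_eq cardB)
  then have "E \<noteq> {}" by auto
  then obtain a0 a0' b0 b0' where ab0: "a0 \<in> A" "a0' \<in> A" "a0 \<noteq> a0'" "b0 \<in> B" "b0' \<in> B" "a0 - a0' = b0 - b0'"
    unfolding E_def differences_def swap.differences_def by auto
  define t where "t = b0 - a0"
  define C where "C = {a \<in> A. t + a \<in> B}"
  have C: "finite C" "C \<subseteq> A" using finite_A by (auto simp: C_def)
  have "E \<subseteq> (\<lambda>(a, a'). a - a') ` (C \<times> C - Id)"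
  proof
    fix x assume "x \<in> E"
    then obtain a a' b b' where ab: "x = a - a'" "a \<in> A" "a' \<in> A" "a \<noteq> a'" "b \<in> B" "b' \<in> B" "a - a' = b - b'"
      unfolding E_def differences_def swap.differences_def by auto
    have offset: "a - b = a0 - b0"
      by (rule common_offset[OF ab(2,3,5,6,4,7) ab0(1,2,4,5,3,6)])
    have "t + a = a - (a0 - b0)" by (simp add: t_def)
    also have "\<dots> = b" by (simp flip: offset)
    finally have b: "t + a = b" .
    have "t + a' = t + a - (a - a')" by simp
    also have "\<dots> = b'" by (simp add: b ab(7))
    finally have "t + a' = b'" .
    with b ab have "(a, a') \<in> C \<times> C - Id" by (simp add: C_def)
    then show "x \<in> (\<lambda>(a, a'). a - a') ` (C \<times> C - Id)"
      unfolding ab(1) by (rule rev_image_eqI) simp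
  qed
  then have "card E \<le> card ((\<lambda>(a, a'). a - a') ` (C \<times> C - Id))"
    using C by (intro card_mono) auto
  also have "\<dots> \<le> card (C \<times> C - Id)" using C by (intro card_image_le) auto
  also have "C \<times> C - Id = C \<times> C - (\<lambda>a. (a, a)) ` C" by auto
  also have "card \<dots> = card (C \<times> C) - card ((\<lambda>a. (a, a)) ` C)"
    using C by (intro card_Diff_subset) auto
  also have "\<dots> = card C * (card C - 1)"
    by (simp add: card_cartesian_product card_image inj_on_def diff_mult_distrib2)
  finally have le: "14 \<le> card C * (card C - 1)" using E by simp
  have "5 \<le> card C"
  proof (rule ccontr)
    assume "\<not> 5 \<le> card C"
    then have "card C * (card C - 1) \<le> 4 * 3" by (intro mult_le_mono) auto
    then show False using le by simp
  qed
  then have "C = A" using card_seteq[OF finite_A C(2)] card_A_eq by simp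
  then have "(+) t ` A \<subseteq> B" by (auto simp: C_def)
  moreover have "card ((+) t ` A) = card B" by (simp add: card_image card_A_eq cardB)
  ultimately have "(+) t ` A = B" using card_subset_eq[OF finite_B] by blast
  then have "B = (+) t ` A" by simp
  then show ?thesis by (rule that)
qed

end

section \<open>Summands of a maximal decomposition\<close>

definition lattice_vecs :: "(real ^ 'n) set \<Rightarrow> (int ^ 'n) set"
  where "lattice_vecs Q = {z. of_int_vec z \<in> Q}"

lemma mem_lattice_vecs [simp]: "z \<in> lattice_vecs Q \<longleftrightarrow> of_int_vec z \<in> Q"
  by (simp add: lattice_vecs_def)

lemma finite_lattice_vecs: "bounded Q \<Longrightarrow> finite (lattice_vecs Q)"
  unfolding lattice_vecs_def by (rule finite_bounded_of_int_vec)

lemma interior_lattice_points_eq: "interior_lattice_points Q = card (lattice_vecs (interior Q))"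
proof -
  have "interior Q \<inter> integer_points = of_int_vec ` lattice_vecs (interior Q)"
    by (auto simp: integer_points_eq_range)
  then show ?thesis
    unfolding interior_lattice_points_def by (simp add: card_image inj_on_def)
qed

text \<open>\<open>V\<close> consists of the extreme points, whose hull is \<open>Q\<close> by
  Krein-Milman. A nonempty interior makes the affine dimension full, which takes more than
  \<open>CARD('n)\<close> points.\<close>

lemma lattice_polytope_vertices:
  fixes Q :: "(real ^ 'n) set"
  assumes Q: "lattice_polytope Q" and int: "interior Q \<noteq> {}"
  obtains V where "V \<subseteq> lattice_vecs Q" "finite V" "CARD('n) < card V"
    "V \<inter> lattice_vecs (interior Q) = {}" "Q = convex hull (of_int_vec ` V)"
proof -
  obtain S where S: "finite S" "S \<subseteq> integer_points" "Q = convex hull S"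
    using Q by (auto simp: lattice_polytope_def)
  define E where "E = {x. x extreme_point_of Q}"
  define V where "V = lattice_vecs E"
  have E: "E \<subseteq> S" "E \<subseteq> Q"
    using extreme_point_of_convex_hull by (auto simp: E_def S(3) extreme_point_of_def)
  then have EV: "E = of_int_vec ` V"
    using S(2) by (auto simp: V_def integer_points_eq_range)
  have "Q = convex hull E"
    unfolding E_def using S(1,3) by (intro Krein_Milman_Minkowski) (auto intro: finite_imp_compact_convex_hull)
  moreover have "CARD('n) < card V"
  proof -
    have "int CARD('n) = aff_dim Q" using aff_dim_nonempty_interior[OF int] by simp
    also have "\<dots> = aff_dim E" using \<open>Q = convex hull E\<close> by (metis aff_dim_convex_hull)
    also have "\<dots> \<le> int (card E) - 1"
      using E(1) S(1) finite_subset by (intro aff_dim_le_card) auto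
    also have "card E = card V" unfolding EV by (simp add: card_image inj_on_def)
    finally show ?thesis by simp
  qed
  moreover have "finite V"
    unfolding V_def using E(1) S(1) by (meson bounded_subset finite_imp_bounded finite_lattice_vecs)
  moreover have "V \<inter> lattice_vecs (interior Q) = {}"
    using extreme_point_not_in_interior[where S = Q] by (auto simp: V_def E_def)
  moreover have "V \<subseteq> lattice_vecs Q" using E(2) by (auto simp: V_def)
  ultimately show ?thesis using that EV by simp
qed

lemma card_lattice_vecs_ge:
  fixes Q :: "(real ^ 'n) set"
  assumes Q: "lattice_polytope Q" and pos: "0 < interior_lattice_points Q"
  shows "CARD('n) + 1 + interior_lattice_points Q \<le> card (lattice_vecs Q)"
proof -
  have "interior Q \<noteq> {}" using pos by (auto simp: interior_lattice_points_def)
  then obtain V where V: "V \<subseteq> lattice_vecs Q" "finite V" "CARD('n) < card V"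
      "V \<inter> lattice_vecs (interior Q) = {}"
    using lattice_polytope_vertices[OF Q] by metis
  have sub: "lattice_vecs (interior Q) \<subseteq> lattice_vecs Q"
    using interior_subset[of Q] by auto
  have fin: "finite (lattice_vecs Q)"
    using Q by (intro finite_lattice_vecs bounded_lattice_polytope)
  have "card V + card (lattice_vecs (interior Q)) = card (V \<union> lattice_vecs (interior Q))"
    using V finite_subset[OF sub fin] by (intro card_Un_disjoint[symmetric]) auto
  also have "\<dots> \<le> card (lattice_vecs Q)"
    using V sub fin by (intro card_mono) auto
  finally show ?thesis using V(3) by (simp add: interior_lattice_points_eq)
qed

text \<open>Turning the barycentric coordinates \<open>u\<close> of \<open>z\<close> into \<open>(1 - u) / (card S - 1)\<close>.\<close>

lemma reflected_point_in_convex_hull: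
  fixes z :: "'a :: real_vector"
  assumes "finite S" "2 \<le> card S" "z \<in> convex hull S"
  shows "(\<Sum>S - z) /\<^sub>R (real (card S) - 1) \<in> convex hull S"
proof -
  obtain u where u: "\<forall>x\<in>S. 0 \<le> u x" "sum u S = 1" "(\<Sum>x\<in>S. u x *\<^sub>R x) = z"
    using assms by (auto simp: convex_hull_finite)
  define m where "m = real (card S) - 1"
  have m: "m > 0" using assms by (simp add: m_def)
  define v where "v x = (1 - u x) / m" for x
  have "0 \<le> v x" if "x \<in> S" for x
    using member_le_sum[of x S u] u that assms(1) m by (simp add: v_def)
  moreover have "sum v S = 1"
    using m u(2) by (simp add: v_def sum_divide_distrib[symmetric] sum_subtractf m_def)
  moreover have "(\<Sum>x\<in>S. v x *\<^sub>R x) = (\<Sum>S - z) /\<^sub>R m"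
    by (simp add: v_def u(3)[symmetric] sum_subtractf[symmetric] scaleR_right.sum
        scaleR_diff_left[symmetric] divide_inverse mult.commute scaleR_scaleR[symmetric] scaleR_diff_right[symmetric] del: scaleR_scaleR)
       (simp add: algebra_simps)
  ultimately show ?thesis
    using assms(1) unfolding m_def by (auto simp: convex_hull_finite)
qed

section \<open>Sums of one, two and three summands in dimension 3\<close>

locale maximal_decomposition_3d =
  fixes P :: "(real ^ 3) set" and Q :: "nat \<Rightarrow> (real ^ 3) set" and N :: nat
  assumes P: "lattice_polytope P" and dec: "maximal_decomposition P N Q"
begin

lemma lattice_polytope_summand: "i \<in> {1..N} \<Longrightarrow> lattice_polytope (Q i)"
  using dec by (auto simp: maximal_decomposition_def nontrivial_lattice_polytope_def)

lemma convex_summand: "i \<in> {1..N} \<Longrightarrow> convex (Q i)"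
  by (simp add: convex_lattice_polytope lattice_polytope_summand)

lemma finite_summand: "i \<in> {1..N} \<Longrightarrow> finite (lattice_vecs (Q i))"
  by (simp add: finite_lattice_vecs bounded_lattice_polytope lattice_polytope_summand)

text \<open>Two of nine lattice points would be congruent mod 2. Their midpoint is then a lattice
  point, and the segment between them is a zonotope with two equal generators inside a single
  summand.\<close>

lemma card_lattice_vecs_le:
  assumes i: "i \<in> {1..N}"
  shows "card (lattice_vecs (Q i)) \<le> 8"
proof (rule ccontr)
  assume "\<not> ?thesis"
  then have "nat 2 ^ CARD(3) < card (lattice_vecs (Q i))" by simp
  then obtain x y where xy: "x \<in> lattice_vecs (Q i)" "y \<in> lattice_vecs (Q i)" "x \<noteq> y" "cong_vec 2 x y"
    by (rule cong_vec_pigeonhole[OF finite_summand[OF i] zero_less_numeral, where f = "\<lambda>x. x"])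
  define w where "w = (\<chi> k. (y $ k - x $ k) div 2)"
  have "2 * w $ k = y $ k - x $ k" for k
    using xy(4) by (simp add: w_def cong_vec_def dvd_diff_commute)
  then have y: "y = x + w + w" by (simp add: vec_eq_iff algebra_simps)
  have mid: "of_int_vec x + of_int_vec w = (1 / 2) *\<^sub>R of_int_vec x + (1 / 2) *\<^sub>R of_int_vec y"
    by (simp add: y vec_eq_iff field_simps)
  have "of_int_vec x + of_int_vec w \<in> Q i"
    unfolding mid using xy convex_summand[OF i] by (intro convexD) auto
  moreover have "of_int_vec x + (of_int_vec w + of_int_vec w) \<in> Q i"
    using xy(2) by (simp only: y of_int_vec_add add.assoc mem_lattice_vecs)
  ultimately have zon: "of_int_vec x + sum_list ys \<in> (\<Sum>k\<in>{i}. Q k)"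
    if "ys \<in> set (subseqs [of_int_vec w, of_int_vec w])" for ys
    using that xy(1) by (auto simp: Let_def)
  have "w \<noteq> 0" using xy(3) y by auto
  show False
  proof (rule maximal_decomposition_no_zonotope[OF P dec])
    show "of_int_vec x + sum_list ys \<in> (\<Sum>k\<in>{i}. Q k)"
      if "ys \<in> set (subseqs [of_int_vec w, of_int_vec w])" for ys
      using that by (rule zon)
  qed (use i \<open>w \<noteq> 0\<close> in auto)
qed

text \<open>The edges only have to be nonzero. Degenerate cases matter: below, three equal edges
  stand for four equally spaced points on a line.\<close>

lemma no_parallelepiped:
  assumes ij: "i \<in> {1..N}" "j \<in> {1..N}" "i \<noteq> j"
    and nz: "x \<noteq> 0" "y \<noteq> 0" "z \<noteq> 0"
    and mem: "{p, p + x, p + y, p + z, p + x + y, p + x + z, p + y + z, p + x + y + z} \<subseteq>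
      lattice_vecs (Q i + Q j)"
  shows False
proof -
  show False
  proof (rule maximal_decomposition_no_zonotope[OF P dec])
    show "of_int_vec p + sum_list ys \<in> (\<Sum>k\<in>{i, j}. Q k)"
      if "ys \<in> set (subseqs [of_int_vec x, of_int_vec y, of_int_vec z])" for ys
      using that mem ij(3) by (auto simp: add.assoc Let_def)
  qed (use ij nz in auto)
qed

lemma add_in_lattice_vecs:
  "a \<in> lattice_vecs X \<Longrightarrow> b \<in> lattice_vecs Y \<Longrightarrow> a + b \<in> lattice_vecs (X + Y)"
  by (simp add: set_plus_intro)

text \<open>A repeated difference spans a possibly degenerate parallelogram in \<open>Q i\<close>
  with edges \<open>a - a'\<close> and \<open>c' - a'\<close>; a segment of \<open>Q j\<close>
  supplies the third edge.\<close>

lemma sidon: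
  assumes ij: "i \<in> {1..N}" "j \<in> {1..N}" "i \<noteq> j" and card: "5 \<le> card (lattice_vecs (Q j))"
    and mem: "{a, a', c, c'} \<subseteq> lattice_vecs (Q i)" and "a \<noteq> a'" and eq: "a - a' = c - c'"
  shows "a = c"
proof (rule ccontr)
  assume "a \<noteq> c"
  have "lattice_vecs (Q j) \<noteq> {}" using card by auto
  then obtain b where b: "b \<in> lattice_vecs (Q j)" by blast
  have "lattice_vecs (Q j) \<noteq> {b}" using card by auto
  then obtain b' where b': "b' \<in> lattice_vecs (Q j)" "b' \<noteq> b" using b by blast
  have c: "c = a - a' + c'" using eq by (simp add: algebra_simps)
  show False
  proof (rule no_parallelepiped[OF ij])
    show "a - a' \<noteq> 0" "c' - a' \<noteq> 0" "b' - b \<noteq> 0"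
      using \<open>a \<noteq> a'\<close> \<open>a \<noteq> c\<close> b' c by auto
    have "{a' + b, a + b, c' + b, a' + b', c + b, a + b', c' + b', c + b'} \<subseteq> lattice_vecs (Q i + Q j)"
      using mem b b'(1) add_in_lattice_vecs[of _ "Q i" _ "Q j"] by simp
    then show "{a' + b, a' + b + (a - a'), a' + b + (c' - a'), a' + b + (b' - b),
        a' + b + (a - a') + (c' - a'), a' + b + (a - a') + (b' - b), a' + b + (c' - a') + (b' - b),
        a' + b + (a - a') + (c' - a') + (b' - b)} \<subseteq> lattice_vecs (Q i + Q j)"
      unfolding c by (simp add: algebra_simps)
  qed
qed

lemma tight_pair_summands:
  assumes ij: "i \<in> {1..N}" "j \<in> {1..N}" "i \<noteq> j"
    and card: "5 \<le> card (lattice_vecs (Q i))" "5 \<le> card (lattice_vecs (Q j))"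
  shows "tight_pair (lattice_vecs (Q i)) (lattice_vecs (Q j))"
proof
  show "a - a' = b - b'"
    if mem: "a \<in> lattice_vecs (Q i)" "a' \<in> lattice_vecs (Q i)" "b \<in> lattice_vecs (Q j)" "b' \<in> lattice_vecs (Q j)"
      and cong: "cong_vec 3 (a - a') (b - b')" for a a' b b'
  proof (rule ccontr)
    assume "a - a' \<noteq> b - b'"
    \<comment> \<open>The points \<open>a + b'\<close> and \<open>a' + b\<close> of the sum are
      congruent mod 3; \<open>w\<close> is a third of the vector between them, and convexity
      supplies the two lattice points in between.\<close>
    define w where "w = (\<chi> k. ((a - a') $ k - (b - b') $ k) div 3)"
    have w3: "3 * w $ k = a $ k - a' $ k - (b $ k - b' $ k)" for k
      using cong by (simp add: w_def cong_vec_def)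
    define p where "p = a' + b"
    have end_eq: "a + b' = p + w + w + w"
    proof -
      have "a $ k + b' $ k = a' $ k + b $ k + w $ k + w $ k + w $ k" for k
        using w3[of k] by linarith
      then show ?thesis by (simp add: p_def vec_eq_iff)
    qed
    have "w \<noteq> 0"
    proof
      assume "w = 0"
      then have "(a - a' - (b - b')) $ k = 0" for k using w3[of k] by simp
      then have "a - a' - (b - b') = 0" by (simp only: vec_eq_iff zero_index simp_thms)
      then show False using \<open>a - a' \<noteq> b - b'\<close> by simp
    qed
    let ?K = "Q i + Q j"
    have "convex ?K" using ij convex_summand by (intro convex_set_plus) auto
    have pK: "p \<in> lattice_vecs ?K"
      unfolding p_def using mem(2,3) by (rule add_in_lattice_vecs)
    have eK: "p + w + w + w \<in> lattice_vecs ?K"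
      unfolding end_eq[symmetric] using mem(1,4) by (rule add_in_lattice_vecs)
    have "of_int_vec (p + w) = (2 / 3) *\<^sub>R of_int_vec p + (1 / 3) *\<^sub>R of_int_vec (p + w + w + w)"
      "of_int_vec (p + w + w) = (1 / 3) *\<^sub>R of_int_vec p + (2 / 3) *\<^sub>R of_int_vec (p + w + w + w)"
      by (simp_all add: vec_eq_iff algebra_simps)
    moreover have "(2 / 3) *\<^sub>R of_int_vec p + (1 / 3) *\<^sub>R of_int_vec (p + w + w + w) \<in> ?K"
      "(1 / 3) *\<^sub>R of_int_vec p + (2 / 3) *\<^sub>R of_int_vec (p + w + w + w) \<in> ?K"
      using pK eK by (intro convexD[OF \<open>convex ?K\<close>]; simp)+
    ultimately have "p + w \<in> lattice_vecs ?K" "p + w + w \<in> lattice_vecs ?K"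
      by (simp_all only: mem_lattice_vecs)
    with pK eK show False
      by (intro no_parallelepiped[OF ij \<open>w \<noteq> 0\<close> \<open>w \<noteq> 0\<close> \<open>w \<noteq> 0\<close>, of p] insert_subsetI empty_subsetI)
  qed
  show "a = c" if "a \<in> lattice_vecs (Q i)" "a' \<in> lattice_vecs (Q i)" "c \<in> lattice_vecs (Q i)"
      "c' \<in> lattice_vecs (Q i)" "a \<noteq> a'" "a - a' = c - c'" for a a' c c'
    using that by (intro sidon[OF ij card(2), of a a' c c']) auto
  show "b = d" if "b \<in> lattice_vecs (Q j)" "b' \<in> lattice_vecs (Q j)" "d \<in> lattice_vecs (Q j)"
      "d' \<in> lattice_vecs (Q j)" "b \<noteq> b'" "b - b' = d - d'" for b b' d d'
    using that by (intro sidon[OF ij(2,1) ij(3)[symmetric] card(1), of b b' d d']) auto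
  show "a - b = c - d"
    if mem: "a \<in> lattice_vecs (Q i)" "a' \<in> lattice_vecs (Q i)" "b \<in> lattice_vecs (Q j)" "b' \<in> lattice_vecs (Q j)"
        "a \<noteq> a'" "a - a' = b - b'"
      "c \<in> lattice_vecs (Q i)" "c' \<in> lattice_vecs (Q i)" "d \<in> lattice_vecs (Q j)" "d' \<in> lattice_vecs (Q j)"
        "c \<noteq> c'" "c - c' = d - d'" for a a' b b' c c' d d'
  proof (rule ccontr)
    assume neq: "a - b \<noteq> c - d"
    have b: "b = a - a' + b'" and d: "d = c - c' + d'" using mem(6,12) by simp_all
    \<comment> \<open>The third edge is the discrepancy of the two offsets up to sign. It joins the
      parallelogram at \<open>a' + d'\<close> to the one at \<open>c' + b'\<close>; both have edges
      \<open>a - a' = b - b'\<close> and \<open>c - c' = d - d'\<close>.\<close>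
    show False
    proof (rule no_parallelepiped[OF ij])
      show "a - a' \<noteq> 0" "c - c' \<noteq> 0" using mem(5,11) by simp_all
      have "a - b - (c - d) = - ((c' + b') - (a' + d'))" unfolding b d by simp
      then show "(c' + b') - (a' + d') \<noteq> 0"
        using neq by (metis neg_equal_0_iff_equal right_minus_eq)
      have "{a' + d', a + d', a' + d, c' + b', a + d, c' + b, c + b', c + b} \<subseteq> lattice_vecs (Q i + Q j)"
        using mem(1-4,7-10) add_in_lattice_vecs[of _ "Q i" _ "Q j"] by simp
      then show "{a' + d', a' + d' + (a - a'), a' + d' + (c - c'), a' + d' + (c' + b' - (a' + d')),
          a' + d' + (a - a') + (c - c'), a' + d' + (a - a') + (c' + b' - (a' + d')),
          a' + d' + (c - c') + (c' + b' - (a' + d')),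
          a' + d' + (a - a') + (c - c') + (c' + b' - (a' + d'))} \<subseteq> lattice_vecs (Q i + Q j)"
        unfolding b d by (simp add: algebra_simps)
    qed
  qed
qed (use ij card finite_summand in auto)

text \<open>If \<open>z0 = (\<Sum>m. u m * z m)\<close> with \<open>u\<close> summing to 1, then the sum of all four generators
  \<open>z m - z0\<close> is \<open>\<Sum>m. (1 - u m) * (z m - z0)\<close>, whose coefficients sum to 3; hence three copies of
  the tetrahedron contain a sum of four segments.\<close>

lemma no_three_translates:
  assumes ijk: "i \<in> {1..N}" "j \<in> {1..N}" "k \<in> {1..N}" "i \<noteq> j" "i \<noteq> k" "j \<noteq> k"
    and V: "V \<subseteq> lattice_vecs (Q i)" "card V = 4" "z0 \<notin> V"
      "of_int_vec z0 \<in> convex hull (of_int_vec ` V)"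
    and j: "(+) t ` V \<subseteq> lattice_vecs (Q j)" and k: "(+) s ` V \<subseteq> lattice_vecs (Q k)"
  shows False
proof -
  define S :: "(real ^ 3) set" where "S = of_int_vec ` V"
  define H where "H = convex hull S"
  define c where "c = of_int_vec t + of_int_vec s"
  let ?K = "Q i + (Q j + Q k)"
  have "finite V" using V(2) by (intro card_ge_0_finite) simp
  have cS: "card S = 4" unfolding S_def using V(2) by (simp add: card_image inj_on_def)
  have Hi: "H \<subseteq> Q i"
    unfolding H_def using V(1) convex_summand[OF ijk(1)] by (intro hull_minimal) (auto simp: S_def)
  have Hj: "(+) (of_int_vec t) ` H \<subseteq> Q j"
    unfolding H_def convex_hull_translation[symmetric]
    using j convex_summand[OF ijk(2)] by (intro hull_minimal) (auto simp: S_def)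
  have Hk: "(+) (of_int_vec s) ` H \<subseteq> Q k"
    unfolding H_def convex_hull_translation[symmetric]
    using k convex_summand[OF ijk(3)] by (intro hull_minimal) (auto simp: S_def)
  have K: "v \<in> ?K" if "x \<in> H" "y \<in> H" "w \<in> H" "v = x + y + w + c" for x y w v
  proof -
    have "x + ((of_int_vec t + y) + (of_int_vec s + w)) \<in> ?K"
      using that Hi Hj Hk by (intro set_plus_intro) auto
    then show ?thesis by (simp add: that(4) c_def algebra_simps)
  qed
  obtain z1 z2 z3 z4 where z: "V = {z1, z2, z3, z4}" "distinct [z1, z2, z3, z4]"
    using V(2) by (auto simp: card_Suc_eq numeral_eq_Suc)
  define o0 where "o0 = of_int_vec z0"
  define g where "g z = of_int_vec z - o0" for z
  have oH: "o0 \<in> H" using V(4) by (simp add: o0_def H_def S_def)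
  have zH: "of_int_vec z \<in> H" if "z \<in> V" for z
    using that hull_subset[of S convex] by (auto simp: H_def S_def)
  define p where "p = o0 + o0 + o0 + c"
  \<comment> \<open>Up to three generators are realised by one vertex in each copy of
    \<open>H\<close>, with \<open>o0\<close> in the remaining copies. Only the sum of all four needs
    the point from \<open>reflected_point_in_convex_hull\<close>, taken in every copy.\<close>
  have p1: "p + g z \<in> ?K" if "z \<in> V" for z
    by (rule K[OF zH[OF that] oH oH]) (simp add: p_def g_def)
  have p2: "p + (g y + g z) \<in> ?K" if "y \<in> V" "z \<in> V" for y z
    by (rule K[OF zH[OF that(1)] zH[OF that(2)] oH]) (simp add: p_def g_def)
  have p3: "p + (g x + (g y + g z)) \<in> ?K" if "x \<in> V" "y \<in> V" "z \<in> V" for x y z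
    by (rule K[OF zH[OF that(1)] zH[OF that(2)] zH[OF that(3)]]) (simp add: p_def g_def)
  have p0: "p \<in> ?K" by (rule K[OF oH oH oH]) (simp add: p_def)
  have p4: "p + (g z1 + (g z2 + (g z3 + g z4))) \<in> ?K"
  proof -
    have "(\<Sum>S - o0) /\<^sub>R (real (card S) - 1) \<in> H"
      unfolding H_def using oH cS by (intro reflected_point_in_convex_hull) (auto simp: H_def S_def \<open>finite V\<close>)
    then have y: "(\<Sum>S - o0) /\<^sub>R 3 \<in> H" by (simp add: cS)
    have sumS: "\<Sum>S = of_int_vec z1 + (of_int_vec z2 + (of_int_vec z3 + of_int_vec z4))"
      using z by (simp add: S_def)
    have "v /\<^sub>R 3 + v /\<^sub>R 3 + v /\<^sub>R 3 = v" for v :: "real ^ 3"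
      by (simp add: vec_eq_iff)
    moreover have "p + (g z1 + (g z2 + (g z3 + g z4))) = (\<Sum>S - o0) + c"
      by (simp add: sumS p_def g_def)
    ultimately show ?thesis by (intro K[OF y y y]) (simp only:)
  qed
  show False
  proof (rule maximal_decomposition_no_zonotope[OF P dec])
    show "p + sum_list ys \<in> (\<Sum>m\<in>{i, j, k}. Q m)"
      if "ys \<in> set (subseqs [g z1, g z2, g z3, g z4])" for ys
    proof -
      have "p + sum_list ys \<in> ?K"
        using that p0 p1 p2 p3 p4 z(1) by (auto simp: Let_def)
      then show ?thesis using ijk by simp
    qed
    show "p \<in> integer_points"
      by (simp add: p_def c_def o0_def flip: of_int_vec_add)
    show "set [g z1, g z2, g z3, g z4] \<subseteq> integer_points - {0}"
      using V(3) z(1) by (auto simp: g_def o0_def simp flip: of_int_vec_diff)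
  qed (use ijk in auto)
qed

section \<open>Counting the summands with interior lattice points\<close>

definition interior_indices :: "nat set"
  where "interior_indices = {i \<in> {1..N}. 0 < interior_lattice_points (Q i)}"

lemma card_lattice_vecs_ge_5:
  assumes "i \<in> interior_indices"
  shows "4 + interior_lattice_points (Q i) \<le> card (lattice_vecs (Q i))" "5 \<le> card (lattice_vecs (Q i))"
  using card_lattice_vecs_ge[of "Q i"] lattice_polytope_summand[of i] assms
  by (auto simp: interior_indices_def)

lemma tight_pair_interior_indices:
  assumes "i \<in> interior_indices" "j \<in> interior_indices" "i \<noteq> j"
  shows "tight_pair (lattice_vecs (Q i)) (lattice_vecs (Q j))"
  using assms card_lattice_vecs_ge_5 by (intro tight_pair_summands) (auto simp: interior_indices_def)

lemma interior_lattice_points_le_1: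
  assumes "i \<in> interior_indices" "j \<in> interior_indices" "i \<noteq> j"
  shows "interior_lattice_points (Q i) \<le> 1"
  using tight_pair.card_A_eq[OF tight_pair_interior_indices[OF assms]] card_lattice_vecs_ge_5(1)[OF assms(1)]
  by simp

lemma card_interior_indices: "card interior_indices \<le> 2"
proof (rule ccontr)
  assume "\<not> ?thesis"
  then obtain T where "T \<subseteq> interior_indices" "card T = 3"
    using obtain_subset_with_card_n[of 3 interior_indices] by auto
  then obtain i j k where ijk: "{i, j, k} \<subseteq> interior_indices" "i \<noteq> j" "i \<noteq> k" "j \<noteq> k"
    unfolding card_3_iff by blast
  have N: "i \<in> {1..N}" "j \<in> {1..N}" "k \<in> {1..N}"
    using ijk by (auto simp: interior_indices_def)
  have tp: "tight_pair (lattice_vecs (Q i)) (lattice_vecs (Q j))"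
      "tight_pair (lattice_vecs (Q i)) (lattice_vecs (Q k))"
    using ijk by (auto intro: tight_pair_interior_indices)
  obtain t where t: "lattice_vecs (Q j) = (+) t ` lattice_vecs (Q i)"
    using tp(1) by (rule tight_pair.translates)
  obtain s where s: "lattice_vecs (Q k) = (+) s ` lattice_vecs (Q i)"
    using tp(2) by (rule tight_pair.translates)
  have "interior (Q i) \<inter> integer_points \<noteq> {}"
    using ijk(1) by (auto simp: interior_indices_def interior_lattice_points_def)
  then obtain z0 where z0: "of_int_vec z0 \<in> interior (Q i)"
    by (auto simp: integer_points_eq_range)
  then have "interior (Q i) \<noteq> {}" by blast
  then obtain V where V: "V \<subseteq> lattice_vecs (Q i)" "finite V" "CARD(3) < card V"
      "V \<inter> lattice_vecs (interior (Q i)) = {}" "Q i = convex hull (of_int_vec ` V)"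
    using lattice_polytope_vertices[OF lattice_polytope_summand[OF N(1)]] by metis
  have z0V: "z0 \<notin> V" "of_int_vec z0 \<in> Q i" using z0 V(4) interior_subset by auto
  \<comment> \<open>\<open>Q i\<close> has exactly five lattice points, and \<open>z0\<close> is one
    that is not a vertex; so the vertices are exactly four and \<open>Q i\<close> is a
    tetrahedron.\<close>
  have "card (insert z0 V) \<le> card (lattice_vecs (Q i))"
    using V(1) z0V finite_summand[OF N(1)] by (intro card_mono) auto
  then have "card V = 4"
    using tight_pair.card_A_eq[OF tp(1)] V(2,3) z0V(1) by simp
  moreover have "(+) t ` V \<subseteq> lattice_vecs (Q j)" "(+) s ` V \<subseteq> lattice_vecs (Q k)"
    unfolding t s by (intro image_mono V(1))+
  moreover have "of_int_vec z0 \<in> convex hull (of_int_vec ` V)"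
    using z0V(2) V(5) by simp
  ultimately show False
    using no_three_translates[OF N ijk(2-4) V(1) _ z0V(1)] by blast
qed

end

theorem theorem3p14:
  fixes P :: "(real ^ 3) set" and Q :: "nat \<Rightarrow> (real ^ 3) set" and N :: nat
  assumes "lattice_polytope P"
    and "maximal_decomposition P N Q"
  shows "(\<Sum>i = 1..N. interior_lattice_points (Q i)) \<le> 4 \<and>
    (card {i \<in> {1..N}. interior_lattice_points (Q i) > 0} > 1 \<longrightarrow>
      (\<Sum>i = 1..N. interior_lattice_points (Q i)) \<le> 2)"
proof -
  interpret maximal_decomposition_3d P Q N
    using assms by unfold_locales
  let ?I = "interior_indices"
  have fin: "finite ?I" by (simp add: interior_indices_def)
  have sum_eq: "(\<Sum>i = 1..N. interior_lattice_points (Q i)) = (\<Sum>i\<in>?I. interior_lattice_points (Q i))"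
    by (rule sum.mono_neutral_right) (auto simp: interior_indices_def)
  show ?thesis
  proof (cases "card ?I > 1")
    case True
    have "interior_lattice_points (Q i) \<le> 1" if i: "i \<in> ?I" for i
    proof -
      have "?I \<noteq> {i}" using True by auto
      then obtain j where "j \<in> ?I" "i \<noteq> j" using i by blast
      then show ?thesis using interior_lattice_points_le_1 i by blast
    qed
    then have "(\<Sum>i\<in>?I. interior_lattice_points (Q i)) \<le> of_nat (card ?I) * 1"
      by (intro sum_bounded_above) auto
    then show ?thesis
      unfolding sum_eq interior_indices_def[symmetric] using card_interior_indices by simp
  next
    case False
    \<comment> \<open>At most 8 lattice points, of which at least 4 are vertices.\<close>
    have "interior_lattice_points (Q i) \<le> 4" if "i \<in> ?I" for i
      using card_lattice_vecs_ge_5(1)[OF that] card_lattice_vecs_le[of i] that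
      by (simp add: interior_indices_def)
    then have "(\<Sum>i\<in>?I. interior_lattice_points (Q i)) \<le> of_nat (card ?I) * 4"
      by (intro sum_bounded_above) auto
    then show ?thesis
      unfolding sum_eq interior_indices_def[symmetric] using False by simp
  qed
qed

end
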